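(* The following quantities attached to a real unital associative algebra $A$ with underlying vector space $\mathbb{R}^n$ ($n\ge1$) are algebra isomorphism invariants (i.e. they take the same value on any two isomorphic such algebras), where $\mathfrak{u}_A$ is the anti-rotor of $A$: (i) the dimension of the real vector space $\mathfrak{u}_A$; (ii) the largest rank of a matrix in $\mathfrak{u}_A$; (iii) the smallest rank of a nonzero matrix in $\mathfrak{u}_A$.
   Context: All algebras are real, unital, associative, with vector space of elements $\mathbb{R}^n$, the standard topology, and the standard basis; elements are column vectors, $^T$ is transpose, and $\cdot$ is the usual dot product. For an algebra $A$ with multiplicative identity $\mathbf{1}$, an uncurling metric of $A$ is a real symmetric $n\times n$ matrix $L$ such that, on some neighborhood of $\mathbf{1}$ consisting only of units (invertible elements), the differential 1-form $(Ls^{-1})\cdot \mathbf{d}s=(s^{-1})^TL\,\mathbf{d}s$ is closed, i.e. $d\big((s^{-1})^TL\,\mathbf{d}s\big)=0$. Here $s^{-1}$ is the multiplicative inverse of $s$ in $A$, $\mathbf{d}s=(dx_1,\dots,dx_n)^T$, and $d$ is the exterior derivative. The set of uncurling metrics of $A$ is a real vector space, called the anti-rotor of $A$ and denoted $\mathfrak{u}_A$. It is known that $\dim\mathfrak{u}_A\ge 1$ always, so nonzero members exist. *)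

theory Defs
  imports "HOL-Analysis.Analysis"
begin

text \<open>
  An algebra is given by its multiplication and its identity on the space \<open>real ^ 'n\<close>.
  Index types are nonempty, so the dimension is at least 1 and the identity is nonzero.
\<close>

definition unital_algebra ::
  "(real ^ 'n \<Rightarrow> real ^ 'n \<Rightarrow> real ^ 'n) \<Rightarrow> real ^ 'n \<Rightarrow> bool" where
  "unital_algebra mul e \<longleftrightarrow>
     bilinear mul \<and>
     (\<forall>x y z. mul (mul x y) z = mul x (mul y z)) \<and>
     (\<forall>x. mul e x = x \<and> mul x e = x)"

definition algebra_iso ::
  "(real ^ 'n \<Rightarrow> real ^ 'n \<Rightarrow> real ^ 'n) \<Rightarrow> real ^ 'n \<Rightarrow>
   (real ^ 'm \<Rightarrow> real ^ 'm \<Rightarrow> real ^ 'm) \<Rightarrow> real ^ 'm \<Rightarrow>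
   (real ^ 'n \<Rightarrow> real ^ 'm) \<Rightarrow> bool" where
  "algebra_iso mulA eA mulB eB f \<longleftrightarrow>
     linear f \<and> bij f \<and> (\<forall>x y. f (mulA x y) = mulB (f x) (f y)) \<and> f eA = eB"

definition isomorphic_algebras ::
  "(real ^ 'n \<Rightarrow> real ^ 'n \<Rightarrow> real ^ 'n) \<Rightarrow> real ^ 'n \<Rightarrow>
   (real ^ 'm \<Rightarrow> real ^ 'm \<Rightarrow> real ^ 'm) \<Rightarrow> real ^ 'm \<Rightarrow> bool" where
  "isomorphic_algebras mulA eA mulB eB \<longleftrightarrow> (\<exists>f. algebra_iso mulA eA mulB eB f)"

definition alg_units ::
  "(real ^ 'n \<Rightarrow> real ^ 'n \<Rightarrow> real ^ 'n) \<Rightarrow> real ^ 'n \<Rightarrow> (real ^ 'n) set" where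
  "alg_units mul e = {s. \<exists>t. mul s t = e \<and> mul t s = e}"

text \<open>Only meaningful for \<open>s \<in> alg_units mul e\<close>.\<close>

definition alg_inverse ::
  "(real ^ 'n \<Rightarrow> real ^ 'n \<Rightarrow> real ^ 'n) \<Rightarrow> real ^ 'n \<Rightarrow> real ^ 'n \<Rightarrow> real ^ 'n" where
  "alg_inverse mul e s = (THE t. mul s t = e \<and> mul t s = e)"

text \<open>
  A differential 1-form \<open>\<omega>\<close> assigns to a point \<open>s\<close> a linear functional \<open>\<omega> s\<close>.  Its exterior
  derivative is evaluated on the constant vector fields \<open>u\<close> and \<open>v\<close>, whose Lie bracket vanishes;
  on the standard basis vectors \<open>i\<close>, \<open>j\<close> this is the coefficient
  \<open>\<partial>\<^sub>i \<omega>\<^sub>j - \<partial>\<^sub>j \<omega>\<^sub>i\<close>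
  of \<open>dx\<^sub>i \<and> dx\<^sub>j\<close>.
\<close>

definition exterior_derivative ::
  "(real ^ 'n \<Rightarrow> real ^ 'n \<Rightarrow> real) \<Rightarrow> real ^ 'n \<Rightarrow> real ^ 'n \<Rightarrow> real ^ 'n \<Rightarrow> real" where
  "exterior_derivative \<omega> s u v =
     frechet_derivative (\<lambda>p. \<omega> p v) (at s) u - frechet_derivative (\<lambda>p. \<omega> p u) (at s) v"

text \<open>
  Differentiability is required explicitly because \<open>frechet_derivative\<close> is unspecified at
  points where the derivative does not exist.  For the form below it excludes nothing, since
  inversion is smooth on the open set of units.
\<close>

definition closed_one_form_on ::
  "(real ^ 'n) set \<Rightarrow> (real ^ 'n \<Rightarrow> real ^ 'n \<Rightarrow> real) \<Rightarrow> bool" where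
  "closed_one_form_on U \<omega> \<longleftrightarrow>
     (\<forall>s\<in>U. linear (\<omega> s) \<and>
            (\<forall>v. (\<lambda>p. \<omega> p v) differentiable (at s)) \<and>
            (\<forall>u v. exterior_derivative \<omega> s u v = 0))"

text \<open>The 1-form \<open>(L s\<^sup>-\<^sup>1) \<cdot> ds\<close>, where \<open>ds\<close> maps a tangent vector \<open>v\<close> to itself.\<close>

definition inverse_one_form ::
  "(real ^ 'n \<Rightarrow> real ^ 'n \<Rightarrow> real ^ 'n) \<Rightarrow> real ^ 'n \<Rightarrow> real ^ 'n ^ 'n \<Rightarrow>
   real ^ 'n \<Rightarrow> real ^ 'n \<Rightarrow> real" where
  "inverse_one_form mul e L s v = (L *v alg_inverse mul e s) \<bullet> v"

definition uncurling_metric ::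
  "(real ^ 'n \<Rightarrow> real ^ 'n \<Rightarrow> real ^ 'n) \<Rightarrow> real ^ 'n \<Rightarrow> real ^ 'n ^ 'n \<Rightarrow> bool" where
  "uncurling_metric mul e L \<longleftrightarrow>
     transpose L = L \<and>
     (\<exists>U. open U \<and> e \<in> U \<and> U \<subseteq> alg_units mul e \<and>
          closed_one_form_on U (inverse_one_form mul e L))"

definition anti_rotor ::
  "(real ^ 'n \<Rightarrow> real ^ 'n \<Rightarrow> real ^ 'n) \<Rightarrow> real ^ 'n \<Rightarrow> (real ^ 'n ^ 'n) set" where
  "anti_rotor mul e = {L. uncurling_metric mul e L}"

end

theory Submission
  imports Defs
begin

text \<open>
  Let \<open>f\<close> be an isomorphism from \<open>A\<close> to \<open>B\<close> with matrix \<open>M\<close>.  Since \<open>f\<close> carries inverses to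
  inverses, substituting \<open>f\<close> into the 1-form \<open>(L s\<^sup>-\<^sup>1) \<cdot> ds\<close> of \<open>B\<close> gives the 1-form
  of \<open>A\<close> for the congruent matrix \<open>M\<^sup>T L M\<close>.  Pullback along a linear map preserves closedness,
  so \<open>L \<mapsto> M\<^sup>T L M\<close> maps the anti-rotor of \<open>B\<close> into that of \<open>A\<close>
  (\<open>pullback_metric_in_anti_rotor\<close>).

  The same argument for the inverse of \<open>f\<close> provides a two-sided inverse of this map.  It is
  therefore a linear bijection of the two anti-rotors, which preserves the dimension and fixes
  the zero matrix, and a congruence by an invertible matrix, which preserves the rank.  Hence
  the two anti-rotors realise the same set of ranks, with or without the zero matrix, and all
  three invariants agree.
\<close>

section \<open>Pullback of a symmetric form along a linear map\<close>

text \<open>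
  The matrix of the bilinear form \<open>(x, y) \<mapsto> (L f(x)) \<cdot> f(y)\<close>, for linear \<open>f\<close>.
\<close>

definition pullback_metric ::
  "(real ^ 'n \<Rightarrow> real ^ 'm) \<Rightarrow> real ^ 'm ^ 'm \<Rightarrow> real ^ 'n ^ 'n" where
  "pullback_metric f L = transpose (matrix f) ** L ** matrix f"

lemma pullback_metric_inner:
  assumes "linear f"
  shows "(pullback_metric f L *v x) \<bullet> y = (L *v f x) \<bullet> f y"
proof -
  have "(pullback_metric f L *v x) \<bullet> y
        = (transpose (matrix f) *v (L *v (matrix f *v x))) \<bullet> y"
    by (simp add: pullback_metric_def matrix_vector_mul_assoc matrix_mul_assoc)
  also have "\<dots> = (L *v (matrix f *v x)) \<bullet> (matrix f *v y)"
    by (simp add: dot_lmul_matrix)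
  finally show ?thesis
    using assms by (simp add: matrix_vector_mul(2)[THEN fun_cong])
qed

lemma transpose_pullback_metric:
  "transpose (pullback_metric f L) = pullback_metric f (transpose L)"
  by (simp add: pullback_metric_def matrix_transpose_mul matrix_mul_assoc)

lemma matrix_add_rdistrib:
  fixes A B :: "'a::semiring_1 ^ 'n ^ 'm" and C :: "'a ^ 'k ^ 'n"
  shows "(A + B) ** C = A ** C + B ** C"
  by (simp add: matrix_matrix_mult_def vec_eq_iff distrib_right sum.distrib)

lemma linear_pullback_metric: "linear (pullback_metric f)"
  by (rule linearI)
    (simp_all add: pullback_metric_def matrix_add_ldistrib matrix_add_rdistrib
      scalar_matrix_assoc matrix_scalar_ac)

lemma pullback_metric_compose:
  fixes f :: "real ^ 'n \<Rightarrow> real ^ 'm" and g :: "real ^ 'm \<Rightarrow> real ^ 'k"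
  assumes "linear f" and "linear g"
  shows "pullback_metric f (pullback_metric g L) = pullback_metric (g \<circ> f) L"
  using assms
  by (simp add: pullback_metric_def matrix_compose matrix_transpose_mul matrix_mul_assoc)

lemma pullback_metric_id: "pullback_metric id L = L"
  by (simp add: pullback_metric_def matrix_id_mat_1)

lemma pullback_metric_inv:
  assumes "linear f" and "linear g" and "g \<circ> f = id"
  shows "pullback_metric f (pullback_metric g L) = L"
  using assms by (simp add: pullback_metric_compose pullback_metric_id)

lemma rank_pullback_metric_le: "rank (pullback_metric f L) \<le> rank L"
  unfolding pullback_metric_def
  by (rule order_trans[OF rank_mul_le_left rank_mul_le_right])

section \<open>Pullback of a closed 1-form along a linear map\<close>

text \<open>
  Because \<open>f\<close> is linear, it sends constant vector fields to constant vector fields, so the chain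
  rule turns the exterior derivative at \<open>s\<close> on \<open>u\<close>, \<open>v\<close> into the one at \<open>f s\<close> on \<open>f u\<close>, \<open>f v\<close>;
  no second derivative of \<open>f\<close> appears.
\<close>

lemma closed_one_form_on_pullback:
  fixes f :: "real ^ 'n \<Rightarrow> real ^ 'm"
  assumes f: "linear f" and closed: "closed_one_form_on U \<omega>"
  shows "closed_one_form_on (f -` U) (\<lambda>s v. \<omega> (f s) (f v))"
  unfolding closed_one_form_on_def
proof (intro ballI conjI allI)
  fix s u v assume s: "s \<in> f -` U"
  have deriv: "((\<lambda>p. \<omega> (f p) (f w)) has_derivative
      (\<lambda>h. frechet_derivative (\<lambda>q. \<omega> q (f w)) (at (f s)) (f h))) (at s)" for w
  proof -
    have "((\<lambda>q. \<omega> q (f w)) has_derivative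
        frechet_derivative (\<lambda>q. \<omega> q (f w)) (at (f s))) (at (f s))"
      using closed s by (simp add: closed_one_form_on_def frechet_derivative_works[symmetric])
    from diff_chain_at[OF linear_imp_has_derivative[OF f] this] show ?thesis
      by (simp add: o_def)
  qed
  have "linear (\<omega> (f s))"
    using closed s by (simp add: closed_one_form_on_def)
  from linear_compose[OF f this] show "linear (\<lambda>v. \<omega> (f s) (f v))"
    by (simp add: o_def)
  show "(\<lambda>p. \<omega> (f p) (f v)) differentiable at s"
    using deriv by (rule differentiableI)
  have "exterior_derivative \<omega> (f s) (f u) (f v) = 0"
    using closed s by (simp add: closed_one_form_on_def)
  then show "exterior_derivative (\<lambda>s v. \<omega> (f s) (f v)) s u v = 0"
    by (simp add: exterior_derivative_def frechet_derivative_at[OF deriv, symmetric])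
qed

text \<open>
  Closedness is local: at points of an open set the derivatives only see the values of the
  form on that set.
\<close>

lemma closed_one_form_on_cong_open:
  assumes "open U" and eq: "\<And>s v. s \<in> U \<Longrightarrow> \<omega> s v = \<eta> s v"
    and closed: "closed_one_form_on U \<omega>"
  shows "closed_one_form_on U \<eta>"
  unfolding closed_one_form_on_def
proof (intro ballI conjI allI)
  fix s u v assume s: "s \<in> U"
  have "\<omega> s = \<eta> s"
    using eq[OF s] by blast
  then show "linear (\<eta> s)"
    using closed s by (metis closed_one_form_on_def)
  have diff: "(\<lambda>p. \<omega> p w) differentiable at s" for w
    using closed s by (simp add: closed_one_form_on_def)
  have deriv: "((\<lambda>p. \<eta> p w) has_derivative frechet_derivative (\<lambda>p. \<omega> p w) (at s)) (at s)" for w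
    using diff[of w, unfolded frechet_derivative_works] \<open>open U\<close> s eq
    by (rule has_derivative_transform_within_open)
  show "(\<lambda>p. \<eta> p v) differentiable at s"
    using deriv by (rule differentiableI)
  have "exterior_derivative \<omega> s u v = 0"
    using closed s by (simp add: closed_one_form_on_def)
  then show "exterior_derivative \<eta> s u v = 0"
    by (simp add: exterior_derivative_def frechet_derivative_at[OF deriv, symmetric])
qed

section \<open>Transport of anti-rotors along an isomorphism\<close>

lemma algebra_iso_inv:
  assumes "algebra_iso mulA eA mulB eB f"
  shows "algebra_iso mulB eB mulA eA (inv f)"
proof -
  have f: "linear f" "bij f" "\<And>x y. f (mulA x y) = mulB (f x) (f y)" "f eA = eB"
    using assms by (auto simp: algebra_iso_def)
  have inv_eq: "inv f y = x" if "f x = y" for x y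
    using f(2) that by (simp add: bij_is_inj inv_f_eq)
  have f_inv: "f (inv f y) = y" for y
    using f(2) by (simp add: bij_is_surj surj_f_inv_f)
  have "inv f (mulB x y) = mulA (inv f x) (inv f y)" for x y
    by (rule inv_eq) (simp add: f(3) f_inv)
  moreover have "linear (inv f)"
  proof (rule linearI)
    show "inv f (x + y) = inv f x + inv f y" for x y
      by (rule inv_eq) (simp add: linear_add[OF f(1)] f_inv)
    show "inv f (c *\<^sub>R x) = c *\<^sub>R inv f x" for c x
      by (rule inv_eq) (simp add: linear_cmul[OF f(1)] f_inv)
  qed
  moreover have "inv f eB = eA"
    using f(4) by (rule inv_eq)
  ultimately show ?thesis
    using f(2) by (simp add: algebra_iso_def bij_imp_bij_inv)
qed

lemma two_sided_inverse_unique: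
  assumes "unital_algebra mul e"
    and "mul s t = e" "mul t s = e" "mul s t' = e" "mul t' s = e"
  shows "t = t'"
proof -
  have assoc: "mul (mul x y) z = mul x (mul y z)" and unit: "mul e x = x" "mul x e = x" for x y z
    using assms(1) by (auto simp: unital_algebra_def)
  have "t = mul t (mul s t')"
    using assms(4) by (simp add: unit)
  also have "\<dots> = t'"
    using assms(3) by (simp add: assoc[symmetric] unit)
  finally show ?thesis .
qed

lemma alg_inverse_eqI:
  assumes "unital_algebra mul e" and "mul s t = e" and "mul t s = e"
  shows "alg_inverse mul e s = t"
  unfolding alg_inverse_def
proof (rule the_equality)
  show "mul s t = e \<and> mul t s = e"
    using assms by simp
  show "t' = t" if "mul s t' = e \<and> mul t' s = e" for t'
    using two_sided_inverse_unique[OF assms(1)] assms(2,3) that by blast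
qed

lemma algebra_iso_inverse_in_units:
  assumes A: "unital_algebra mulA eA" and B: "unital_algebra mulB eB"
    and iso: "algebra_iso mulA eA mulB eB f" and unit: "f s \<in> alg_units mulB eB"
  shows "s \<in> alg_units mulA eA"
    and "f (alg_inverse mulA eA s) = alg_inverse mulB eB (f s)"
proof -
  obtain t where t: "mulB (f s) t = eB" "mulB t (f s) = eB"
    using unit by (auto simp: alg_units_def)
  have f: "inj f" "surj f" "\<And>x y. f (mulA x y) = mulB (f x) (f y)" "f eA = eB"
    using iso by (auto simp: algebra_iso_def bij_def)
  obtain r where r: "t = f r"
    using f(2) by blast
  have "f (mulA s r) = f eA" "f (mulA r s) = f eA"
    using t r f by simp_all
  then have sr: "mulA s r = eA" "mulA r s = eA"
    using f(1) by (simp_all add: inj_eq)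
  then show "s \<in> alg_units mulA eA"
    by (auto simp: alg_units_def)
  show "f (alg_inverse mulA eA s) = alg_inverse mulB eB (f s)"
    using alg_inverse_eqI[OF A sr] alg_inverse_eqI[OF B t] r by simp
qed

text \<open>
  On the preimage of a neighbourhood of units the form of \<open>A\<close> for the pulled back metric is
  the pullback of the form of \<open>B\<close>, because the isomorphism commutes with inversion there.
\<close>

lemma pullback_metric_in_anti_rotor:
  assumes A: "unital_algebra mulA eA" and B: "unital_algebra mulB eB"
    and iso: "algebra_iso mulA eA mulB eB f" and L: "L \<in> anti_rotor mulB eB"
  shows "pullback_metric f L \<in> anti_rotor mulA eA"
proof -
  have f: "linear f" "f eA = eB"
    using iso by (auto simp: algebra_iso_def)
  from L obtain U where U: "open U" "eB \<in> U" "U \<subseteq> alg_units mulB eB"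
    and closed: "closed_one_form_on U (inverse_one_form mulB eB L)"
    and sym: "transpose L = L"
    by (auto simp: anti_rotor_def uncurling_metric_def)
  let ?V = "f -` U"
  have "continuous_on UNIV f"
    using f(1) by (intro linear_continuous_on linear_conv_bounded_linear[THEN iffD1])
  then have "open ?V"
    using U(1) by (rule open_vimage[rotated])
  moreover have "eA \<in> ?V"
    using U(2) f(2) by simp
  moreover have "?V \<subseteq> alg_units mulA eA"
    using U(3) algebra_iso_inverse_in_units(1)[OF A B iso] by blast
  moreover have "closed_one_form_on ?V (inverse_one_form mulA eA (pullback_metric f L))"
  proof (rule closed_one_form_on_cong_open[OF \<open>open ?V\<close>])
    show "closed_one_form_on ?V (\<lambda>s v. inverse_one_form mulB eB L (f s) (f v))"
      using f(1) closed by (rule closed_one_form_on_pullback)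
    show "inverse_one_form mulB eB L (f s) (f v)
        = inverse_one_form mulA eA (pullback_metric f L) s v" if "s \<in> ?V" for s v
      using that U(3) algebra_iso_inverse_in_units(2)[OF A B iso, of s]
      by (auto simp: inverse_one_form_def pullback_metric_inner[OF f(1)])
  qed
  moreover have "transpose (pullback_metric f L) = pullback_metric f L"
    by (simp add: transpose_pullback_metric sym)
  ultimately show ?thesis
    by (auto simp: anti_rotor_def uncurling_metric_def)
qed

theorem corollary2p4:
  fixes mulA :: "real ^ 'n \<Rightarrow> real ^ 'n \<Rightarrow> real ^ 'n" and eA :: "real ^ 'n"
    and mulB :: "real ^ 'm \<Rightarrow> real ^ 'm \<Rightarrow> real ^ 'm" and eB :: "real ^ 'm"
  assumes "unital_algebra mulA eA"
    and "unital_algebra mulB eB"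
    and "isomorphic_algebras mulA eA mulB eB"
  shows "dim (anti_rotor mulA eA) = dim (anti_rotor mulB eB) \<and>
         Max (rank ` anti_rotor mulA eA) = Max (rank ` anti_rotor mulB eB) \<and>
         Min (rank ` (anti_rotor mulA eA - {0})) = Min (rank ` (anti_rotor mulB eB - {0}))"
proof -
  obtain f where iso: "algebra_iso mulA eA mulB eB f"
    using assms(3) by (auto simp: isomorphic_algebras_def)
  define \<Phi> where "\<Phi> = pullback_metric f"
  define \<Psi> where "\<Psi> = pullback_metric (inv f)"
  have iso': "algebra_iso mulB eB mulA eA (inv f)"
    using iso by (rule algebra_iso_inv)
  have lin: "linear f" "linear (inv f)" and "bij f"
    using iso iso' by (auto simp: algebra_iso_def)
  then have comp: "inv f \<circ> f = id" "f \<circ> inv f = id"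
    by (simp_all add: bij_is_inj bij_is_surj surj_iff[symmetric])
  have \<Phi>\<Psi>: "\<Phi> (\<Psi> L) = L" for L
    using lin comp by (simp add: \<Phi>_def \<Psi>_def pullback_metric_inv)
  have \<Psi>\<Phi>: "\<Psi> (\<Phi> L) = L" for L
    using lin comp by (simp add: \<Phi>_def \<Psi>_def pullback_metric_inv)
  have "linear \<Phi>"
    unfolding \<Phi>_def by (rule linear_pullback_metric)
  have "inj \<Phi>"
    using \<Psi>\<Phi> by (rule inj_on_inverseI)
  \<comment> \<open>Pulling back never raises the rank, and \<open>L\<close> is itself a pullback of \<open>\<Phi> L\<close>.\<close>
  have rank: "rank (\<Phi> L) = rank L" for L
    using rank_pullback_metric_le[of f L] rank_pullback_metric_le[of "inv f" "\<Phi> L"] \<Psi>\<Phi>[of L]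
    by (simp add: \<Phi>_def \<Psi>_def)
  have image: "anti_rotor mulA eA = \<Phi> ` anti_rotor mulB eB"
  proof
    show "\<Phi> ` anti_rotor mulB eB \<subseteq> anti_rotor mulA eA"
      using pullback_metric_in_anti_rotor[OF assms(1,2) iso] by (auto simp: \<Phi>_def)
    show "anti_rotor mulA eA \<subseteq> \<Phi> ` anti_rotor mulB eB"
    proof
      fix L assume "L \<in> anti_rotor mulA eA"
      then have "\<Psi> L \<in> anti_rotor mulB eB"
        unfolding \<Psi>_def by (rule pullback_metric_in_anti_rotor[OF assms(2,1) iso'])
      then have "\<Phi> (\<Psi> L) \<in> \<Phi> ` anti_rotor mulB eB"
        by (rule imageI)
      then show "L \<in> \<Phi> ` anti_rotor mulB eB"
        by (simp only: \<Phi>\<Psi>)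
    qed
  qed
  have image_nonzero: "anti_rotor mulA eA - {0} = \<Phi> ` (anti_rotor mulB eB - {0})"
    using image_set_diff[OF \<open>inj \<Phi>\<close>] linear_0[OF \<open>linear \<Phi>\<close>] by (simp add: image)
  have "dim (anti_rotor mulA eA) = dim (anti_rotor mulB eB)"
    unfolding image using \<open>linear \<Phi>\<close> \<open>inj \<Phi>\<close> by (intro dim_image_eq) (auto intro: inj_on_subset)
  moreover have "rank ` anti_rotor mulA eA = rank ` anti_rotor mulB eB"
    by (simp add: image image_image rank)
  moreover have "rank ` (anti_rotor mulA eA - {0}) = rank ` (anti_rotor mulB eB - {0})"
    by (simp add: image_nonzero image_image rank)
  ultimately show ?thesis
    by simp
qed

end
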